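(* Let $X$ be a finite set and let $b\in\mathcal{P}(X)$. The Hasse diagram of $(\mathcal{P}(X),\leq_b)$ is characterized by the following property: for $p,p'\in\mathcal{P}(X)$, there exists an oriented edge from $p'$ to $p$ if and only if - either $p'$ is directly smaller than $p$ for the finer-compatible order $\sqsupset_b$, - or $p'$ is directly smaller than $p$ for the coarser-compatible order $\dashv_b$.
   Context: $\mathcal{P}(X)$ is the set of partitions of $X$; $\mathrm{nc}(p)$ is the number of blocks of $p$; $p$ is finer than $p'$ (equivalently $p'$ is coarser than $p$) if every block of $p$ is contained in a block of $p'$; $p\vee p'$ is the finest partition coarser than both. The distance is $d(p,p')=\frac12(\mathrm{nc}(p)+\mathrm{nc}(p'))-\mathrm{nc}(p\vee p')$. For a base partition $b\in\mathcal{P}(X)$, the following are partial orders on $\mathcal{P}(X)$: - geodesic order: $p'\leq_b p$ if $d(b,p')+d(p',p)=d(b,p)$; - coarser-compatible (coarser-admissible) order: $p'\dashv_b p$ if $p'$ is coarser than $p$ and $\mathrm{nc}(p'\vee b)=\mathrm{nc}(p\vee b)$; here $p'$ is regarded as the smaller element; - finer-compatible (finer-admissible) order: $p'\sqsupset_b p$ if $p'$ is finer than $p$ and $\mathrm{nc}(p')-\mathrm{nc}(p'\vee b)=\mathrm{nc}(p)-\mathrm{nc}(p\vee b)$; here $p'$ is regarded as the smaller element. For a partially ordered finite set, $x$ is directly smaller than $y$ if $x<y$ and there is no $z$ with $x<z<y$. The Hasse diagram is the oriented graph on the set with an oriented edge from $x$ to $y$ if and only if $x$ is directly smaller than $y$.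 *)

theory Defs
  imports Complex_Main "HOL-Library.Disjoint_Sets" "Graph_Theory.Pair_Digraph"
begin

text \<open>
  A partition \<open>p\<close> of \<open>X\<close> is the set of its (non-empty) blocks. That \<open>p\<close> is finer than \<open>p'\<close>,
  equivalently \<open>p'\<close> is coarser than \<open>p\<close>, is the library predicate \<open>refines X p p'\<close>, which includes
  that both are partitions of \<open>X\<close>. In particular every partition is finer and coarser than itself.
\<close>

definition partitions :: "'a set \<Rightarrow> 'a set set set" where
  "partitions X = {p. partition_on X p}"

abbreviation nc :: "'a set set \<Rightarrow> nat" where
  "nc p \<equiv> card p"

definition part_join :: "'a set \<Rightarrow> 'a set set \<Rightarrow> 'a set set \<Rightarrow> 'a set set" where
  "part_join X p p' = (THE q. refines X p q \<and> refines X p' q \<and>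
     (\<forall>r. refines X p r \<and> refines X p' r \<longrightarrow> refines X q r))"

lemma part_join_ex1:
  assumes p: "partition_on X p" and p': "partition_on X p'"
  shows "\<exists>!q. refines X p q \<and> refines X p' q \<and>
     (\<forall>r. refines X p r \<and> refines X p' r \<longrightarrow> refines X q r)"
proof -
  define R where "R = {r. refines X p r \<and> refines X p' r}"
  have part: "partition_on X r" if "r \<in> R" for r
    using that by (auto simp: R_def refines_def)
  have ne: "R \<noteq> {}"
  proof (cases "X = {}")
    case True
    then have "p = {}" "p' = {}" using p p' by (auto simp: partition_on_empty)
    then have "{} \<in> R" using p by (auto simp: R_def refines_def)
    then show ?thesis by blast
  next
    case False
    then have "{X} \<in> R"
      using p p' partition_on_space[OF False] by (auto simp: R_def refines_def partition_on_def)
    then show ?thesis by blast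
  qed
  let ?q = "common_refinement R"
  have "refines X p ?q" "refines X p' ?q"
    using p p' part ne by (auto intro!: common_refinement_coarsest simp: R_def)
  moreover have "refines X ?q r" if "refines X p r" "refines X p' r" for r
    using that part by (intro refines_common_refinement) (auto simp: R_def)
  ultimately show ?thesis
    by (metis refines_asym)
qed

lemma part_join:
  assumes "partition_on X p" "partition_on X p'"
  shows "refines X p (part_join X p p')" "refines X p' (part_join X p p')"
    and "refines X p r \<Longrightarrow> refines X p' r \<Longrightarrow> refines X (part_join X p p') r"
  using theI'[OF part_join_ex1[OF assms]] unfolding part_join_def by blast+

definition part_dist :: "'a set \<Rightarrow> 'a set set \<Rightarrow> 'a set set \<Rightarrow> real" where
  "part_dist X p p' = (real (nc p) + real (nc p')) / 2 - real (nc (part_join X p p'))"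

text \<open>An order is a set of pairs \<open>(smaller, larger)\<close>.\<close>

definition geodesic_order :: "'a set \<Rightarrow> 'a set set \<Rightarrow> 'a set set rel" where
  "geodesic_order X b = {(p', p). p' \<in> partitions X \<and> p \<in> partitions X \<and>
     part_dist X b p' + part_dist X p' p = part_dist X b p}"

definition coarser_compatible_order :: "'a set \<Rightarrow> 'a set set \<Rightarrow> 'a set set rel" where
  "coarser_compatible_order X b = {(p', p). p' \<in> partitions X \<and> p \<in> partitions X \<and>
     refines X p p' \<and> nc (part_join X p' b) = nc (part_join X p b)}"

definition finer_compatible_order :: "'a set \<Rightarrow> 'a set set \<Rightarrow> 'a set set rel" where
  "finer_compatible_order X b = {(p', p). p' \<in> partitions X \<and> p \<in> partitions X \<and>
     refines X p' p \<and>
     int (nc p') - int (nc (part_join X p' b)) = int (nc p) - int (nc (part_join X p b))}"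

definition directly_smaller :: "'v rel \<Rightarrow> 'v \<Rightarrow> 'v \<Rightarrow> bool" where
  "directly_smaller r x y \<longleftrightarrow>
     (x, y) \<in> r - Id \<and> (\<nexists>z. (x, z) \<in> r - Id \<and> (z, y) \<in> r - Id)"

definition hasse_diagram :: "'v set \<Rightarrow> 'v rel \<Rightarrow> 'v pair_pre_digraph" where
  "hasse_diagram A r =
     \<lparr> pverts = A, parcs = {(x, y). x \<in> A \<and> y \<in> A \<and> directly_smaller r x y} \<rparr>"

end

theory Submission
  imports Defs
begin

text \<open>
  Merging two blocks of a partition lowers the number of blocks of its join with \<open>b\<close> by at most one.
  Hence, if \<open>p\<close> is finer than \<open>q\<close>, passing from \<open>p\<close> to \<open>q\<close> loses at least as many blocks as passing
  from \<open>p \<or> b\<close> to \<open>q \<or> b\<close>. The triangle defect \<open>d(b,p') + d(p',p) - d(b,p)\<close> is the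
  sum of two nonnegative terms, the surplus of this inequality for \<open>p'\<close> and \<open>q = p' \<or> p\<close>, and
  \<open>nc (p \<or> b) - nc (q \<or> b)\<close>; their vanishing says that \<open>p' \<or> p\<close> lies
  above \<open>p'\<close> for the finer-compatible order and below \<open>p\<close> for the coarser-compatible one. So the
  two endpoints of a Hasse edge are comparable for refinement. Conversely, if \<open>p'\<close> and \<open>p\<close> are
  comparable for refinement, everything on a geodesic between them lies between them for refinement.
\<close>

section \<open>Refinement and numbers of blocks\<close>

lemma refines_partition_on:
  assumes "refines X p q"
  shows "partition_on X p" "partition_on X q"
  using assms by (auto simp: refines_def)

text \<open>Choose in each block of \<open>q\<close> a block of \<open>p\<close> contained in it.
  The choice is injective, since a nonempty block cannot lie in two disjoint blocks.\<close>

lemma refines_card_le: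
  assumes "finite X" "refines X p q"
  shows "card q \<le> card p"
proof -
  note pq = refines_partition_on[OF assms(2)]
  have ex: "\<exists>B\<in>p. B \<subseteq> C" if "C \<in> q" for C
  proof -
    have "partition_on C {B \<in> p. B \<subseteq> C}"
      by (rule refines_obtains_subset[OF assms(2) that])
    moreover have "C \<noteq> {}" using that pq(2) by (auto simp: partition_on_def)
    ultimately show ?thesis by (auto simp: partition_on_def)
  qed
  then obtain f where f: "\<And>C. C \<in> q \<Longrightarrow> f C \<in> p \<and> f C \<subseteq> C" by metis
  have "inj_on f q"
  proof (rule inj_onI)
    fix C D assume CD: "C \<in> q" "D \<in> q" "f C = f D"
    have "f C \<noteq> {}" using f[OF CD(1)] pq(1) by (auto simp: partition_on_def)
    then have "C \<inter> D \<noteq> {}" using f[OF CD(1)] f[OF CD(2)] CD(3) by auto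
    then show "C = D" using CD pq(2) by (auto simp: partition_on_def disjoint_def)
  qed
  moreover have "f ` q \<subseteq> p" using f by auto
  ultimately show ?thesis
    using finite_elements[OF assms(1) pq(1)] by (rule card_inj_on_le)
qed

section \<open>Merging two blocks\<close>

definition merge_blocks :: "'a set set \<Rightarrow> 'a set \<Rightarrow> 'a set \<Rightarrow> 'a set set" where
  "merge_blocks p B C = insert (B \<union> C) (p - {B, C})"

lemma partition_on_merge_blocks:
  assumes "partition_on X p" "B \<in> p" "C \<in> p"
  shows "partition_on X (merge_blocks p B C)"
proof -
  note disj = pairwiseD[OF partition_onD2[OF assms(1)]]
  have "\<Union> (merge_blocks p B C) = \<Union> p"
    using assms(2,3) by (auto simp: merge_blocks_def)
  moreover have "disjnt (B \<union> C) D" if "D \<in> p - {B, C}" for D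
    using that assms(2,3) disj[of B D] disj[of C D] by (auto simp: disjnt_Un1)
  then have "disjoint (merge_blocks p B C)"
    using pairwise_subset[OF partition_onD2[OF assms(1)], of "p - {B, C}"]
    by (auto simp: merge_blocks_def pairwise_insert disjnt_sym)
  moreover have "{} \<notin> merge_blocks p B C"
    using assms by (auto simp: merge_blocks_def partition_on_def)
  ultimately show ?thesis using assms(1) by (simp add: partition_on_def)
qed

lemma refines_merge_blocks:
  assumes "partition_on X p" "B \<in> p" "C \<in> p"
  shows "refines X p (merge_blocks p B C)"
  using assms partition_on_merge_blocks[OF assms]
  by (auto simp: refines_def merge_blocks_def)

lemma merge_blocks_refines:
  assumes "refines X p q" "B \<in> p" "C \<in> p" "D \<in> q" "B \<union> C \<subseteq> D"
  shows "refines X (merge_blocks p B C) q"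
  unfolding refines_def
proof (intro conjI ballI)
  note pq = refines_partition_on[OF assms(1)]
  show "partition_on X (merge_blocks p B C)" "partition_on X q"
    using partition_on_merge_blocks[OF pq(1) assms(2,3)] pq(2) by auto
  fix E assume "E \<in> merge_blocks p B C"
  then have "E = B \<union> C \<or> E \<in> p" by (auto simp: merge_blocks_def)
  then show "\<exists>F\<in>q. E \<subseteq> F" using assms(1,4,5) unfolding refines_def by blast
qed

text \<open>The count would fail if \<open>B \<union> C\<close> were already one of the remaining
  blocks. Such a block would be disjoint from the nonempty \<open>B\<close>.\<close>

lemma card_merge_blocks:
  assumes "finite p" "partition_on X p" "B \<in> p" "C \<in> p" "B \<noteq> C"
  shows "card p = Suc (card (merge_blocks p B C))"
proof -
  have "B \<union> C \<notin> p - {B, C}"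
  proof
    assume E: "B \<union> C \<in> p - {B, C}"
    then have "disjnt (B \<union> C) B"
      using pairwiseD[OF partition_onD2[OF assms(2)], of "B \<union> C" B] assms(3) by simp
    then have "B = {}" by (auto simp: disjnt_def)
    then show False using assms(3) partition_onD3[OF assms(2)] by simp
  qed
  then have "card (merge_blocks p B C) = Suc (card (p - {B, C}))"
    using assms(1) by (simp add: merge_blocks_def)
  moreover have "p \<inter> {B, C} = {B, C}" using assms(3,4) by auto
  then have "card p = 2 + card (p - {B, C})"
    using card_Int_Diff[OF assms(1), of "{B, C}"] assms(5) by simp
  ultimately show ?thesis by simp
qed

text \<open>Some block \<open>D\<close> of \<open>q\<close> lies in no block of \<open>p\<close>, so
  the blocks of \<open>p\<close> that fill it number at least two. They can be merged without
  leaving the partitions finer than \<open>q\<close>.\<close>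

lemma refines_neq_obtains:
  assumes "refines X p q" "p \<noteq> q"
  obtains B C D where "B \<in> p" "C \<in> p" "B \<noteq> C" "D \<in> q" "B \<union> C \<subseteq> D"
proof -
  note pq = refines_partition_on[OF assms(1)]
  have "\<not> refines X q p" using assms refines_asym by blast
  then obtain D where D: "D \<in> q" "\<And>B. B \<in> p \<Longrightarrow> \<not> D \<subseteq> B"
    using pq by (auto simp: refines_def)
  have part: "partition_on D {B \<in> p. B \<subseteq> D}"
    by (rule refines_obtains_subset[OF assms(1) D(1)])
  obtain x where x: "x \<in> D" using D(1) pq by (fastforce simp: partition_on_def)
  then obtain B where B: "B \<in> p" "B \<subseteq> D" using part by (auto simp: partition_on_def)
  obtain y where "y \<in> D" "y \<notin> B" using D(2)[OF B(1)] by auto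
  then obtain C where "C \<in> p" "C \<subseteq> D" "y \<in> C" using part by (fastforce simp: partition_on_def)
  then show ?thesis using that[of B C D] B D(1) \<open>y \<notin> B\<close> by blast
qed

text \<open>If \<open>p\<close> and \<open>q\<close> differed, one merge would give a partition
  still finer than \<open>q\<close> with fewer blocks than \<open>q\<close>. This turns equal block
  counts into equal partitions.\<close>

lemma refines_card_eq:
  assumes "finite X" "refines X p q" "card p \<le> card q"
  shows "p = q"
proof (rule ccontr)
  assume "p \<noteq> q"
  then obtain B C D where BCD: "B \<in> p" "C \<in> p" "B \<noteq> C" "D \<in> q" "B \<union> C \<subseteq> D"
    using refines_neq_obtains[OF assms(2)] by metis
  note p = refines_partition_on(1)[OF assms(2)]
  have "card q \<le> card (merge_blocks p B C)"
    using refines_card_le[OF assms(1) merge_blocks_refines[OF assms(2) BCD(1,2,4,5)]] .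
  then show False
    using card_merge_blocks[OF finite_elements[OF assms(1) p] p BCD(1-3)] assms(3) by simp
qed

section \<open>Joins and their numbers of blocks\<close>

lemma part_join_commute: "part_join X p q = part_join X q p"
  unfolding part_join_def by (rule arg_cong[where f = The]) blast

lemma part_join_partition_on:
  assumes "partition_on X p" "partition_on X q"
  shows "partition_on X (part_join X p q)"
  using part_join(1)[OF assms] by (rule refines_partition_on)

lemma part_join_absorb:
  assumes "refines X p q"
  shows "part_join X p q = q"
proof -
  note pq = refines_partition_on[OF assms]
  show ?thesis
    using refines_asym part_join(2)[OF pq] part_join(3)[OF pq assms refines_refl[OF pq(2)]] by blast
qed

text \<open>In the join, merge the blocks \<open>B'\<close> and \<open>C'\<close> that contain
  \<open>B\<close> and \<open>C\<close>. The result is coarser than both the merged \<open>p\<close>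
  and \<open>b\<close>, hence than their join, and it has lost at most one block, none if
  \<open>B' = C'\<close>.\<close>

lemma card_part_join_merge_blocks:
  assumes "finite X" "partition_on X p" "partition_on X b" "B \<in> p" "C \<in> p"
  shows "card (part_join X p b) \<le> Suc (card (part_join X (merge_blocks p B C) b))"
proof -
  let ?j = "part_join X p b" and ?m = "merge_blocks p B C"
  note j = part_join_partition_on[OF assms(2,3)]
  note m = partition_on_merge_blocks[OF assms(2,4,5)]
  obtain B' C' where BC: "B' \<in> ?j" "C' \<in> ?j" "B \<subseteq> B'" "C \<subseteq> C'"
    using part_join(1)[OF assms(2,3)] assms(4,5) unfolding refines_def by meson
  note j' = refines_merge_blocks[OF j BC(1,2)]
  have "refines X ?m (merge_blocks ?j B' C')"
  proof (rule merge_blocks_refines[OF _ assms(4,5)])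
    show "refines X p (merge_blocks ?j B' C')"
      using refines_trans[OF part_join(1)[OF assms(2,3)] j'] .
    show "B' \<union> C' \<in> merge_blocks ?j B' C'" by (simp add: merge_blocks_def)
    show "B \<union> C \<subseteq> B' \<union> C'" using BC by auto
  qed
  moreover have "refines X b (merge_blocks ?j B' C')"
    using refines_trans[OF part_join(2)[OF assms(2,3)] j'] .
  ultimately have "refines X (part_join X ?m b) (merge_blocks ?j B' C')"
    by (rule part_join(3)[OF m assms(3)])
  from refines_card_le[OF assms(1) this] have "card (merge_blocks ?j B' C') \<le> card (part_join X ?m b)" .
  moreover have "card ?j \<le> Suc (card (merge_blocks ?j B' C'))"
  proof (cases "B' = C'")
    case True
    then show ?thesis using BC by (simp add: merge_blocks_def insert_absorb)
  next
    case False
    then show ?thesis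
      using card_merge_blocks[OF finite_elements[OF assms(1) j] j BC(1,2)] by simp
  qed
  ultimately show ?thesis by linarith
qed

text \<open>Go from \<open>p\<close> to \<open>q\<close> by successive merges inside blocks of
  \<open>q\<close>. Each merge costs \<open>p\<close> exactly one block and its join with
  \<open>b\<close> at most one.\<close>

lemma card_part_join_submodular:
  assumes "finite X" "partition_on X b" "refines X p q"
  shows "card (part_join X p b) + card q \<le> card p + card (part_join X q b)"
  using assms(3)
proof (induction "card p" arbitrary: p rule: less_induct)
  case less
  show ?case
  proof (cases "p = q")
    case False
    then obtain B C D where BCD: "B \<in> p" "C \<in> p" "B \<noteq> C" "D \<in> q" "B \<union> C \<subseteq> D"
      using refines_neq_obtains[OF less.prems] by metis
    note p = refines_partition_on(1)[OF less.prems]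
    note card = card_merge_blocks[OF finite_elements[OF assms(1) p] p BCD(1-3)]
    have "card (part_join X (merge_blocks p B C) b) + card q
        \<le> card (merge_blocks p B C) + card (part_join X q b)"
      using card merge_blocks_refines[OF less.prems BCD(1,2,4,5)] by (intro less.hyps) auto
    then show ?thesis
      using card card_part_join_merge_blocks[OF assms(1) p assms(2) BCD(1,2)] by linarith
  qed simp
qed

lemma card_part_join_le:
  assumes "finite X" "partition_on X p" "partition_on X q"
  shows "card (part_join X p q) \<le> card p" "card (part_join X p q) \<le> card q"
  using part_join(1,2)[OF assms(2,3)] refines_card_le[OF assms(1)] by blast+

lemma card_part_join_antimono:
  assumes "finite X" "partition_on X b" "refines X p q"
  shows "card (part_join X q b) \<le> card (part_join X p b)"
proof -
  note pq = refines_partition_on[OF assms(3)]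
  have "refines X (part_join X p b) (part_join X q b)"
    using part_join[OF pq(1) assms(2)] part_join[OF pq(2) assms(2)] refines_trans[OF assms(3)] by blast
  then show ?thesis by (rule refines_card_le[OF assms(1)])
qed

section \<open>The geodesic order in terms of the two compatible orders\<close>

lemma geodesic_order_iff:
  assumes "finite X" "partition_on X b" "partition_on X p" "partition_on X p'"
  shows "(p', p) \<in> geodesic_order X b \<longleftrightarrow>
    (p', part_join X p' p) \<in> finer_compatible_order X b \<and>
    (part_join X p' p, p) \<in> coarser_compatible_order X b"
proof -
  let ?q = "part_join X p' p"
  note q = part_join_partition_on[OF assms(4,3)]
  note le = part_join(1,2)[OF assms(4,3)]
  have "card (part_join X p' b) + card ?q \<le> card p' + card (part_join X ?q b)"
    by (rule card_part_join_submodular[OF assms(1,2) le(1)])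
  moreover have "card (part_join X ?q b) \<le> card (part_join X p b)"
    by (rule card_part_join_antimono[OF assms(1,2) le(2)])
  \<comment> \<open>The halves cancel in the triangle defect, leaving the sum of the slacks of these
    two inequalities. It vanishes exactly when both are equalities.\<close>
  ultimately show ?thesis
    using assms q le
    unfolding geodesic_order_def finer_compatible_order_def coarser_compatible_order_def
      partitions_def part_dist_def part_join_commute[of X b]
    by (auto simp: field_simps)
qed

text \<open>Here the join of \<open>p'\<close> and \<open>p\<close> is \<open>p\<close>, so the
  coarser-compatible half of the criterion is reflexivity.\<close>

lemma finer_compatible_order_iff:
  assumes "finite X" "partition_on X b"
  shows "(p', p) \<in> finer_compatible_order X b \<longleftrightarrow>
    (p', p) \<in> geodesic_order X b \<and> refines X p' p"
proof (cases "refines X p' p")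
  case True
  note pp = refines_partition_on[OF True]
  show ?thesis
    unfolding geodesic_order_iff[OF assms pp(2,1)] part_join_absorb[OF True]
    using True pp by (auto simp: coarser_compatible_order_def partitions_def refines_refl)
qed (auto simp: finer_compatible_order_def)

lemma coarser_compatible_order_iff:
  assumes "finite X" "partition_on X b"
  shows "(p', p) \<in> coarser_compatible_order X b \<longleftrightarrow>
    (p', p) \<in> geodesic_order X b \<and> refines X p p'"
proof (cases "refines X p p'")
  case True
  note pp = refines_partition_on[OF True]
  show ?thesis
    unfolding geodesic_order_iff[OF assms pp] part_join_commute[of X p'] part_join_absorb[OF True]
    using True pp by (auto simp: finer_compatible_order_def partitions_def refines_refl)
qed (auto simp: coarser_compatible_order_def)

text \<open>Combining the three equalities eliminates the distances from \<open>b\<close> and leaves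
  \<open>d(p',z) + d(z,p) = d(p',p)\<close>, written here in block counts.\<close>

lemma geodesic_between_card:
  assumes "(p', p) \<in> geodesic_order X b" "(p', z) \<in> geodesic_order X b" "(z, p) \<in> geodesic_order X b"
  shows "card (part_join X p' z) + card (part_join X z p) = card z + card (part_join X p' p)"
  using assms by (auto simp: geodesic_order_def part_dist_def field_simps)

text \<open>When \<open>p'\<close> and \<open>p\<close> are comparable, their join is the coarser
  one. The count identity then forces equality in the upper bounds for the two joins with
  \<open>z\<close>, so each join equals one of its arguments.\<close>

lemma geodesic_between_refines:
  assumes "finite X"
    and "(p', p) \<in> geodesic_order X b" "(p', z) \<in> geodesic_order X b" "(z, p) \<in> geodesic_order X b"
  shows "refines X p' p \<Longrightarrow> refines X p' z \<and> refines X z p"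
    and "refines X p p' \<Longrightarrow> refines X p z \<and> refines X z p'"
proof -
  have part: "partition_on X p'" "partition_on X z" "partition_on X p"
    using assms by (auto simp: geodesic_order_def partitions_def)
  note le = card_part_join_le[OF assms(1) part(1,2)] card_part_join_le[OF assms(1) part(2,3)]
  note eq = geodesic_between_card[OF assms(2-4)]
  note j1 = part_join(1,2)[OF part(1,2)] and j2 = part_join(1,2)[OF part(2,3)]
  note mono = refines_card_eq[OF assms(1)]
  {
    assume r: "refines X p' p"
    have "card z \<le> card (part_join X p' z)" "card p \<le> card (part_join X z p)"
      using eq le part_join_absorb[OF r] by simp_all
    then show "refines X p' z \<and> refines X z p"
      using mono[OF j1(2)] mono[OF j2(2)] j1 j2 by metis
  next
    assume r: "refines X p p'"
    have "card p' \<le> card (part_join X p' z)" "card z \<le> card (part_join X z p)"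
      using eq le part_join_absorb[OF r] part_join_commute[of X p p'] by simp_all
    then show "refines X p z \<and> refines X z p'"
      using mono[OF j1(1)] mono[OF j2(1)] j1 j2 by metis
  }
qed

theorem theorem2p4:
  fixes X :: "'a set" and b p p' :: "'a set set"
  assumes "finite X"
    and "b \<in> partitions X"
    and "p \<in> partitions X" and "p' \<in> partitions X"
  shows "(p', p) \<in> parcs (hasse_diagram (partitions X) (geodesic_order X b)) \<longleftrightarrow>
    directly_smaller (finer_compatible_order X b) p' p \<or>
    directly_smaller (coarser_compatible_order X b) p' p"
proof -
  have part: "partition_on X b" "partition_on X p" "partition_on X p'"
    using assms by (auto simp: partitions_def)
  note finer = finer_compatible_order_iff[OF assms(1) part(1)]
  note coarser = coarser_compatible_order_iff[OF assms(1) part(1)]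
  have "directly_smaller (geodesic_order X b) p' p \<longleftrightarrow>
    directly_smaller (finer_compatible_order X b) p' p \<or>
    directly_smaller (coarser_compatible_order X b) p' p" (is "?G \<longleftrightarrow> ?F \<or> ?C")
  proof
    assume G: ?G
    let ?q = "part_join X p' p"
    have g: "(p', p) \<in> geodesic_order X b" and "p' \<noteq> p"
      using G by (auto simp: directly_smaller_def)
    then have q: "(p', ?q) \<in> finer_compatible_order X b" "(?q, p) \<in> coarser_compatible_order X b"
      using geodesic_order_iff[OF assms(1) part] by blast+
    then have "(p', ?q) \<in> geodesic_order X b" "(?q, p) \<in> geodesic_order X b"
      using finer coarser by blast+
    \<comment> \<open>The join is a geodesic intermediate point, so the edge leaves it no place but
      an endpoint.\<close>
    then have "?q = p' \<or> ?q = p"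
      using G by (auto simp: directly_smaller_def)
    then have "(p', p) \<in> finer_compatible_order X b \<or> (p', p) \<in> coarser_compatible_order X b"
      using q by metis
    \<comment> \<open>Both compatible orders are contained in the geodesic one, so an element
      strictly between for either would also break the edge.\<close>
    then show "?F \<or> ?C"
      using G finer coarser unfolding directly_smaller_def by blast
  next
    assume "?F \<or> ?C"
    then show ?G
    proof
      \<comment> \<open>A geodesic intermediate point would lie between \<open>p'\<close> and
        \<open>p\<close> for refinement too, hence for the finer-compatible order.\<close>
      assume ?F
      then show ?G
        using finer geodesic_between_refines(1)[OF assms(1)] unfolding directly_smaller_def by blast
    next
      assume ?C
      then show ?G
        using coarser geodesic_between_refines(2)[OF assms(1)] unfolding directly_smaller_def by blast
    qed
  qed
  then show ?thesis
    using assms by (simp add: hasse_diagram_def)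
qed

end
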